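(* Let $\alpha \in (0,1)$ and $\beta > \alpha$. Suppose that there exist $C < \infty$, $c>0$, and $x_0 < \infty$ for which, for all $t \in \mathbb{Z}^+$, $$\mathbb{E} [ (\Delta_t^-)^\beta \mid \mathcal{F}_t ] \leq C \quad \text{a.s.},$$ and, for all $x \geq x_0$ and all $t \in \mathbb{Z}^+$, $$\mathbb{P} [ \Delta_t^+ > x \mid \mathcal{F}_t ] \geq c x^{-\alpha} \quad \text{a.s.}$$ Then for any $\varepsilon>0$, a.s., for all but finitely many $t \in \mathbb{Z}^+$, $$X_t \geq t^{1/\alpha} (\log t)^{-(1/\alpha)-\varepsilon}.$$
   Context: $\mathbb{Z}^+ = \{0,1,2,\ldots\}$. $(X_t)_{t \in \mathbb{Z}^+}$ is a real-valued stochastic process adapted to a filtration $(\mathcal{F}_t)_{t \in \mathbb{Z}^+}$, with $X_0 = 0$ (no Markov property is assumed). Its increments are $\Delta_t := X_{t+1} - X_t$. For real $x$, $x^+ := x \mathbf{1}\{x>0\}$ and $x^- := -x\mathbf{1}\{x<0\}$; $\Delta_t^\pm := (\Delta_t)^\pm$. The constants $c, C, x_0$ are non-random and do not depend on $t$; $x_0$ is understood to be positive so that powers of $x \geq x_0$ are defined. *)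

theory Defs
  imports "HOL-Probability.Probability"
begin

definition plus_part :: "real \<Rightarrow> real" where
  "plus_part x = (if x > 0 then x else 0)"

definition minus_part :: "real \<Rightarrow> real" where
  "minus_part x = (if x < 0 then - x else 0)"

definition increment :: "(nat \<Rightarrow> 'a \<Rightarrow> real) \<Rightarrow> nat \<Rightarrow> 'a \<Rightarrow> real" where
  "increment X t \<omega> = X (Suc t) \<omega> - X t \<omega>"

definition adapted :: "(nat \<Rightarrow> 'a measure) \<Rightarrow> (nat \<Rightarrow> 'a \<Rightarrow> real) \<Rightarrow> bool" where
  "adapted F X \<longleftrightarrow> (\<forall>t. X t \<in> borel_measurable (F t))"

(* The conditional probability of the event A given the sub-sigma-algebra G.
   HOL-Probability's cond_prob conditions on an event instead. *)
definition prob_given :: "'a measure \<Rightarrow> 'a measure \<Rightarrow> 'a set \<Rightarrow> 'a \<Rightarrow> real" where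
  "prob_given M G A = real_cond_exp M G (indicator A)"

end

theory Submission
  imports Defs "HOL-Real_Asymp.Real_Asymp"
begin

text \<open>
  The lower bound on \<open>X t\<close> comes from a single big jump. Among the first \<open>t\<close> increments, each of
  which exceeds \<open>x\<close> with conditional probability at least \<open>c * x powr - \<alpha>\<close>, none exceeds \<open>x\<close> with
  probability at most \<open>exp (- c * t * x powr - \<alpha>)\<close> (\<open>prob_none_occurs_le_exp\<close>). When \<open>x\<close> is
  twice the claimed bound \<open>t powr (1 / \<alpha>) * ln t powr (- (1 / \<alpha>) - \<epsilon>)\<close>, the exponent is a
  constant times \<open>ln t powr (1 + \<alpha> * \<epsilon>)\<close>. The power above \<open>1\<close> makes these probabilities summable
  over all \<open>t\<close>, so by the Borel--Cantelli lemma, almost surely for all large \<open>t\<close> some increment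
  before time \<open>t\<close> is larger than twice the bound.

  The downward increments cannot undo this jump. Their moments of order \<open>b = min \<beta> 1\<close> are bounded,
  so the sum over \<open>s\<close> of \<open>(\<Delta>\<^sub>s\<^sup>-) powr b\<close>, weighted by \<open>(s + 1) powr - (1 + \<delta>)\<close>, has finite
  expectation and is almost surely finite (\<open>AE_partial_sums_le_powr\<close>). Hence the partial sums of
  \<open>(\<Delta>\<^sub>s\<^sup>-) powr b\<close> are at most a random constant times \<open>t powr (1 + \<delta>)\<close>. As \<open>b \<le> 1\<close>, the total
  downward movement is then of order \<open>t powr ((1 + \<delta>) / b)\<close> (\<open>sum_le_sum_powr\<close>). Since \<open>b > \<alpha>\<close>,
  \<open>\<delta>\<close> can be chosen so that this exponent is below \<open>1 / \<alpha>\<close>, and the downward movement is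
  eventually at most the claimed bound itself.
\<close>

text \<open>The \<open>\<ell>\<^sup>1\<close> norm is at most the \<open>\<ell>\<^sup>b\<close> quasinorm: each \<open>u i\<close> is at most that quasinorm, so in
  \<open>u i = u i powr b * u i powr (1 - b)\<close> the second factor is bounded uniformly in \<open>i\<close>.\<close>

lemma sum_le_sum_powr:
  fixes u :: "'i \<Rightarrow> real"
  assumes "finite I" and nonneg: "\<And>i. i \<in> I \<Longrightarrow> 0 \<le> u i" and "0 < b" "b \<le> 1"
  shows "(\<Sum>i\<in>I. u i) \<le> (\<Sum>i\<in>I. u i powr b) powr (1 / b)"
proof -
  define T where "T = (\<Sum>i\<in>I. u i powr b)"
  have T0: "0 \<le> T"
    unfolding T_def by (intro sum_nonneg) auto
  have "u i \<le> u i powr b * T powr ((1 - b) / b)" if i: "i \<in> I" for i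
  proof -
    have "u i powr b \<le> T"
      unfolding T_def using assms(1) i by (intro member_le_sum) auto
    then have "(u i powr b) powr ((1 - b) / b) \<le> T powr ((1 - b) / b)"
      using assms by (intro powr_mono2) auto
    then have "u i powr (1 - b) \<le> T powr ((1 - b) / b)"
      using assms by (simp add: powr_powr)
    then have "u i powr b * u i powr (1 - b) \<le> u i powr b * T powr ((1 - b) / b)"
      by (intro mult_left_mono) auto
    moreover have "u i powr b * u i powr (1 - b) = u i"
      using nonneg[OF i] by (simp add: powr_add[symmetric])
    ultimately show ?thesis by simp
  qed
  then have "(\<Sum>i\<in>I. u i) \<le> T * T powr ((1 - b) / b)"
    unfolding T_def sum_distrib_right by (intro sum_mono)
  also have "\<dots> = T powr 1 * T powr ((1 - b) / b)"
    using T0 by simp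
  also have "\<dots> = T powr (1 / b)"
    unfolding powr_add[symmetric] using \<open>0 < b\<close> by (simp add: field_simps)
  finally show ?thesis by (simp add: T_def)
qed

text \<open>The weighted series \<open>\<Sum>s. Y s * (s + 1) powr - (1 + \<delta>)\<close> has finite expectation, hence a finite
  value \<open>W\<close> almost surely; on \<open>s < t\<close> the weights are at least \<open>t powr - (1 + \<delta>)\<close>.\<close>

lemma AE_partial_sums_le_powr:
  fixes Y :: "nat \<Rightarrow> 'a \<Rightarrow> real" and K :: ennreal
  assumes [measurable]: "\<And>s. Y s \<in> borel_measurable M"
    and nonneg: "\<And>s \<omega>. 0 \<le> Y s \<omega>"
    and mean: "\<And>s. (\<integral>\<^sup>+\<omega>. ennreal (Y s \<omega>) \<partial>M) \<le> K" and "K < \<infinity>" and "0 < \<delta>"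
  shows "AE \<omega> in M. \<exists>W. \<forall>t. (\<Sum>s<t. Y s \<omega>) \<le> W * real t powr (1 + \<delta>)"
proof -
  define w where "w s = real (Suc s) powr (- (1 + \<delta>))" for s
  have w0: "0 \<le> w s" for s
    by (simp add: w_def)
  have "summable w"
    using \<open>0 < \<delta>\<close> summable_real_powr_iff[of "- (1 + \<delta>)"]
    unfolding w_def by (subst summable_Suc_iff) simp
  have "(\<integral>\<^sup>+\<omega>. (\<Sum>s. ennreal (Y s \<omega> * w s)) \<partial>M) = (\<Sum>s. \<integral>\<^sup>+\<omega>. ennreal (Y s \<omega>) * ennreal (w s) \<partial>M)"
    by (subst nn_integral_suminf) (auto simp: ennreal_mult nonneg w0)
  also have "\<dots> \<le> (\<Sum>s. K * ennreal (w s))"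
    by (intro suminf_le) (auto simp: nn_integral_multc intro!: mult_right_mono mean)
  also have "\<dots> = K * ennreal (suminf w)"
    using \<open>summable w\<close> by (simp add: suminf_ennreal2 w0)
  also have "\<dots> < \<infinity>"
    using \<open>K < \<infinity>\<close> by (simp add: ennreal_mult_less_top)
  finally have "AE \<omega> in M. (\<Sum>s. ennreal (Y s \<omega> * w s)) \<noteq> \<infinity>"
    by (intro nn_integral_PInf_AE) auto
  then show ?thesis
  proof eventually_elim
    case (elim \<omega>)
    define W where "W = enn2real (\<Sum>s. ennreal (Y s \<omega> * w s))"
    have "(\<Sum>s<t. Y s \<omega>) \<le> W * real t powr (1 + \<delta>)" for t
    proof -
      have "ennreal (\<Sum>s<t. Y s \<omega> * w s) = (\<Sum>s<t. ennreal (Y s \<omega> * w s))"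
        by (rule sum_ennreal[symmetric]) (simp add: nonneg w0)
      also have "\<dots> \<le> (\<Sum>s. ennreal (Y s \<omega> * w s))"
        by (intro sum_le_suminf) auto
      also have "\<dots> = ennreal W"
        using elim by (simp add: W_def less_top)
      finally have W: "(\<Sum>s<t. Y s \<omega> * w s) \<le> W"
        by (subst (asm) ennreal_le_iff) (auto simp: W_def)
      have "Y s \<omega> \<le> Y s \<omega> * w s * real t powr (1 + \<delta>)" if "s < t" for s
      proof -
        have "1 = w s * real (Suc s) powr (1 + \<delta>)"
          by (simp add: w_def powr_add[symmetric])
        also have "\<dots> \<le> w s * real t powr (1 + \<delta>)"
          using that \<open>0 < \<delta>\<close> by (intro mult_left_mono powr_mono2 w0) auto
        finally show ?thesis
          using mult_left_mono[OF _ nonneg[of s \<omega>]] by (fastforce simp: mult.assoc)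
      qed
      then have "(\<Sum>s<t. Y s \<omega>) \<le> (\<Sum>s<t. Y s \<omega> * w s) * real t powr (1 + \<delta>)"
        unfolding sum_distrib_right by (intro sum_mono) auto
      also have "\<dots> \<le> W * real t powr (1 + \<delta>)"
        using W by (intro mult_right_mono) auto
      finally show ?thesis .
    qed
    then show ?case by blast
  qed
qed

text \<open>Given the past, in which no \<open>B s\<close> with \<open>s < t\<close> has occurred, \<open>B t\<close> fails with conditional
  probability at most \<open>1 - p \<le> exp (- p)\<close>; so each step contributes a factor \<open>exp (- p)\<close>.\<close>

lemma (in prob_space) prob_none_occurs_le_exp:
  assumes filt: "filtration (space M) F" and subalg: "\<And>t. subalgebra M (F t)"
    and B: "\<And>s. B s \<in> sets (F (Suc s))"
    and p: "\<And>s. AE \<omega> in M. p \<le> prob_given M (F s) (B s) \<omega>"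
  shows "prob {\<omega> \<in> space M. \<forall>s<t. \<omega> \<notin> B s} \<le> exp (- (p * real t))"
proof (induction t)
  case 0
  then show ?case by simp
next
  case (Suc t)
  define A where "A = {\<omega> \<in> space M. \<forall>s<t. \<omega> \<notin> B s}"
  interpret finite_measure_subalgebra M "F t"
    by unfold_locales (rule subalg)
  have sp: "space (F t) = space M"
    using subalg by (auto simp: subalgebra_def)
  have "B s \<in> sets (F t)" if "s < t" for s
    using B[of s] that filtration.sets_F_mono[OF filt, of "Suc s" t] by auto
  moreover have "A = space (F t) - (\<Union>s<t. B s)"
    by (auto simp: A_def sp)
  ultimately have A: "A \<in> sets (F t)"
    by auto
  have A_M [measurable]: "A \<in> sets M" and B_M [measurable]: "B t \<in> sets M"
    using A B[of t] assms(2)[of t] assms(2)[of "Suc t"] by (auto simp: subalgebra_def)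
  have int: "integrable M (indicator (B t) :: 'a \<Rightarrow> real)"
    by (simp add: integrable_indicator_iff emeasure_eq_measure)
  have "p * prob A = (\<integral>\<omega>\<in>A. p \<partial>M)"
    by (simp add: set_lebesgue_integral_def mult.commute)
  also have "\<dots> \<le> (\<integral>\<omega>\<in>A. prob_given M (F t) (B t) \<omega> \<partial>M)"
    unfolding set_lebesgue_integral_def
  proof (rule integral_mono_AE)
    show "integrable M (\<lambda>\<omega>. indicat_real A \<omega> *\<^sub>R prob_given M (F t) (B t) \<omega>)"
      unfolding prob_given_def by (intro integrable_mult_indicator A_M real_cond_exp_int(1) int)
    show "AE \<omega> in M. indicat_real A \<omega> *\<^sub>R p \<le> indicat_real A \<omega> *\<^sub>R prob_given M (F t) (B t) \<omega>"
      using p[of t] by eventually_elim (auto simp: indicator_def)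
  qed (simp add: integrable_indicator_iff emeasure_eq_measure)
  also have "\<dots> = (\<integral>\<omega>\<in>A. indicator (B t) \<omega> \<partial>M)"
    unfolding prob_given_def by (rule real_cond_exp_intA[OF int A, symmetric])
  also have "\<dots> = prob (A \<inter> B t)"
    by (simp add: set_lebesgue_integral_def indicator_inter_arith[symmetric])
  finally have hit: "p * prob A \<le> prob (A \<inter> B t)" .
  have "{\<omega> \<in> space M. \<forall>s<Suc t. \<omega> \<notin> B s} = A - (A \<inter> B t)"
    by (auto simp: A_def less_Suc_eq)
  then have "prob {\<omega> \<in> space M. \<forall>s<Suc t. \<omega> \<notin> B s} = prob A - prob (A \<inter> B t)"
    by (simp add: finite_measure_Diff)
  also have "\<dots> \<le> (1 - p) * prob A"
    using hit by (simp add: algebra_simps)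
  also have "\<dots> \<le> exp (- p) * prob A"
    using exp_ge_add_one_self[of "- p"] by (intro mult_right_mono) auto
  also have "\<dots> \<le> exp (- p) * exp (- (p * real t))"
    using Suc.IH by (intro mult_left_mono) (auto simp: A_def)
  also have "\<dots> = exp (- (p * real (Suc t)))"
    by (simp add: exp_add[symmetric] algebra_simps)
  finally show ?case .
qed

lemma exp_ln_powr_summable:
  fixes k \<gamma> :: real
  assumes "0 < k" "1 < \<gamma>"
  shows "summable (\<lambda>t. exp (- (k * ln (real t) powr \<gamma>)))"
proof (rule summable_comparison_test_ev)
  have "\<forall>\<^sub>F t in sequentially. 2 * ln (real t) \<le> k * ln (real t) powr \<gamma>"
    using assms by real_asymp
  then show "\<forall>\<^sub>F t in sequentially. norm (exp (- (k * ln (real t) powr \<gamma>))) \<le> real t powr (-2)"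
    using eventually_gt_at_top[of 0] by eventually_elim (simp add: powr_def)
  show "summable (\<lambda>t. real t powr (-2))"
    using summable_real_powr_iff[of "-2"] by simp
qed

text \<open>The series in the last hypothesis dominates the probabilities that no \<open>D s\<close> with \<open>s < t\<close>
  exceeds \<open>x t\<close>. The Borel--Cantelli lemma applies to it directly, along all \<open>t\<close> and without
  passing to a subsequence.\<close>

lemma (in prob_space) AE_eventually_big_jump:
  fixes D :: "nat \<Rightarrow> 'a \<Rightarrow> real"
  assumes filt: "filtration (space M) F" and subalg: "\<And>t. subalgebra M (F t)"
    and meas: "\<And>s. D s \<in> borel_measurable (F (Suc s))"
    and tail: "\<And>x t. x \<ge> x0 \<Longrightarrow>
        AE \<omega> in M. c * x powr (- \<alpha>) \<le> prob_given M (F t) {\<omega> \<in> space M. D t \<omega> > x} \<omega>"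
    and large: "\<forall>\<^sub>F t in sequentially. x t \<ge> x0"
    and summ: "summable (\<lambda>t. exp (- (c * x t powr (- \<alpha>) * real t)))"
  shows "AE \<omega> in M. \<forall>\<^sub>\<infinity>t. \<exists>s<t. D s \<omega> > x t"
proof -
  define N where "N t = {\<omega> \<in> space M. \<forall>s<t. \<omega> \<notin> {\<omega> \<in> space M. D s \<omega> > x t}}" for t
  have sp: "space (F s) = space M" for s
    using subalg by (auto simp: subalgebra_def)
  have ev: "{\<omega> \<in> space M. D s \<omega> > y} \<in> sets (F (Suc s))" for s y
    using borel_measurable_less[OF borel_measurable_const meas] by (simp add: sp)
  have ev_M [measurable]: "{\<omega> \<in> space M. D s \<omega> > y} \<in> sets M" for s y
    using ev[of y s] subalg by (auto simp: subalgebra_def)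
  have "N t = space M - (\<Union>s<t. {\<omega> \<in> space M. D s \<omega> > x t})" for t
    by (auto simp: N_def)
  then have N_M [measurable]: "N t \<in> sets M" for t
    by auto
  have "\<forall>\<^sub>F t in sequentially. prob (N t) \<le> exp (- (c * x t powr (- \<alpha>) * real t))"
    using large
  proof eventually_elim
    case (elim t)
    then show ?case
      unfolding N_def by (intro prob_none_occurs_le_exp[OF filt subalg ev] tail)
  qed
  then have "summable (\<lambda>t. prob (N t))"
    by (intro summable_comparison_test_ev[OF _ summ]) (auto elim: eventually_mono)
  then have "AE \<omega> in M. \<forall>\<^sub>F t in sequentially. \<omega> \<in> space M - N t"
    by (intro borel_cantelli_AE1) (auto simp: emeasure_eq_measure)
  then show ?thesis
    unfolding cofinite_eq_sequentially
    by eventually_elim (auto elim!: eventually_mono simp: N_def not_less)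
qed

theorem theorem2p3:
  fixes M :: "'a measure" and F :: "nat \<Rightarrow> 'a measure" and X :: "nat \<Rightarrow> 'a \<Rightarrow> real"
    and \<alpha> \<beta> c x\<^sub>0 \<epsilon> :: real and C :: ennreal
  assumes "prob_space M"
    and "filtration (space M) F"
    and "\<And>t. subalgebra M (F t)"
    and "adapted F X"
    and "\<And>\<omega>. \<omega> \<in> space M \<Longrightarrow> X 0 \<omega> = 0"
    and "0 < \<alpha>" and "\<alpha> < 1" and "\<alpha> < \<beta>"
    and "C < \<infinity>" and "0 < c" and "0 < x\<^sub>0"
    and "\<And>t. AE \<omega> in M.
           nn_cond_exp M (F t) (\<lambda>\<omega>. ennreal (minus_part (increment X t \<omega>) powr \<beta>)) \<omega> \<le> C"
    and "\<And>x t. x \<ge> x\<^sub>0 \<Longrightarrow> AE \<omega> in M.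
           prob_given M (F t) {\<omega> \<in> space M. plus_part (increment X t \<omega>) > x} \<omega> \<ge> c * x powr (- \<alpha>)"
    and "0 < \<epsilon>"
  shows "AE \<omega> in M. \<forall>\<^sub>\<infinity>t. X t \<omega> \<ge> real t powr (1 / \<alpha>) * ln (real t) powr (- (1 / \<alpha>) - \<epsilon>)"
proof -
  interpret prob_space M by fact
  define bd where "bd t = real t powr (1 / \<alpha>) * ln (real t) powr (- (1 / \<alpha>) - \<epsilon>)" for t :: nat
  define P where "P s \<omega> = plus_part (increment X s \<omega>)" for s \<omega>
  define N where "N s \<omega> = minus_part (increment X s \<omega>)" for s \<omega>
  have N0: "0 \<le> N s \<omega>" and P0: "0 \<le> P s \<omega>" for s \<omega>
    by (auto simp: N_def P_def minus_part_def plus_part_def)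
  have X_F: "X s \<in> borel_measurable (F t)" if "s \<le> t" for s t
  proof -
    have "X s \<in> borel_measurable (F s)"
      using assms(4) by (simp add: adapted_def)
    moreover have "subalgebra (F t) (F s)"
      using assms(3) filtration.sets_F_mono[OF assms(2) that] by (auto simp: subalgebra_def)
    ultimately show ?thesis by (rule measurable_from_subalg[rotated])
  qed
  have P_F: "P s \<in> borel_measurable (F (Suc s))" and N_F: "N s \<in> borel_measurable (F (Suc s))" for s
    using X_F[of s "Suc s"] X_F[of "Suc s" "Suc s"]
    unfolding P_def N_def plus_part_def minus_part_def increment_def by measurable
  have N_M [measurable]: "N s \<in> borel_measurable M" for s
    by (rule measurable_from_subalg[OF assms(3) N_F])

  have jump: "AE \<omega> in M. \<forall>\<^sub>\<infinity>t. \<exists>s<t. P s \<omega> > 2 * bd t"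
  proof (rule AE_eventually_big_jump[OF assms(2,3) P_F, where c = c and \<alpha> = \<alpha> and ?x0.0 = x\<^sub>0])
    show "AE \<omega> in M. c * x powr - \<alpha> \<le> prob_given M (F t) {\<omega> \<in> space M. x < P t \<omega>} \<omega>"
      if "x\<^sub>0 \<le> x" for x t
      using assms(13)[OF that] by (simp add: P_def)
    show "\<forall>\<^sub>F t in sequentially. x\<^sub>0 \<le> 2 * bd t"
      unfolding bd_def using assms(6,14) by real_asymp
    have "\<forall>\<^sub>F t in sequentially. c * (2 * bd t) powr (- \<alpha>) * real t
        = c * 2 powr (- \<alpha>) * ln (real t) powr (1 + \<alpha> * \<epsilon>)"
      using eventually_gt_at_top[of 1]
    proof eventually_elim
      case (elim t)
      have exponent: "(- (1 / \<alpha>) - \<epsilon>) * (- \<alpha>) = 1 + \<alpha> * \<epsilon>"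
        using assms(6) by (simp add: field_simps)
      have "(2 * bd t) powr (- \<alpha>)
          = 2 powr (- \<alpha>) * (real t powr (-1) * ln (real t) powr (1 + \<alpha> * \<epsilon>))"
        using assms(6) elim by (simp only: bd_def powr_mult powr_powr exponent) simp
      then show ?case
        using elim by (simp add: powr_minus_divide)
    qed
    then have "\<forall>\<^sub>F t in sequentially. exp (- (c * (2 * bd t) powr (- \<alpha>) * real t))
        = exp (- (c * 2 powr (- \<alpha>) * ln (real t) powr (1 + \<alpha> * \<epsilon>)))"
      by eventually_elim simp
    moreover have "summable (\<lambda>t. exp (- (c * 2 powr (- \<alpha>) * ln (real t) powr (1 + \<alpha> * \<epsilon>))))"
      using assms(6,10,14) by (intro exp_ln_powr_summable) auto
    ultimately show "summable (\<lambda>t. exp (- (c * (2 * bd t) powr (- \<alpha>) * real t)))"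
      by (subst summable_cong)
  qed

  \<comment> \<open>\<open>b \<le> 1\<close> is what the comparison of sums needs, and \<open>b > \<alpha>\<close> leaves room for a
    \<open>\<delta> > 0\<close>; this \<open>\<delta>\<close> puts \<open>1 + \<delta>\<close> midway between \<open>1\<close> and \<open>b / \<alpha>\<close>.\<close>
  define b where "b = min \<beta> 1"
  define \<delta> where "\<delta> = (b / \<alpha> - 1) / 2"
  have b: "0 < b" "b \<le> 1" "b \<le> \<beta>" "\<alpha> < b"
    using assms(6-8) by (auto simp: b_def)
  have \<delta>: "0 < \<delta>" "(1 + \<delta>) / b < 1 / \<alpha>"
    using b assms(6) by (auto simp: \<delta>_def field_simps)

  have "(\<integral>\<^sup>+\<omega>. ennreal (N s \<omega> powr b) \<partial>M) \<le> 1 + C" for s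
  proof -
    interpret finite_measure_subalgebra M "F s"
      by unfold_locales (rule assms(3))
    \<comment> \<open>Lowering the order of the moment to \<open>b\<close> costs at most the constant \<open>1\<close>.\<close>
    have "u powr b \<le> 1 + u powr \<beta>" if "0 \<le> u" for u :: real
    proof (cases "u \<le> 1")
      case True
      then have "u powr b \<le> 1"
        using that b by (intro powr_le1) auto
      then show ?thesis by (simp add: add_increasing2)
    next
      case False
      then have "u powr b \<le> u powr \<beta>"
        using b by (intro powr_mono) auto
      then show ?thesis by simp
    qed
    then have "(\<integral>\<^sup>+\<omega>. ennreal (N s \<omega> powr b) \<partial>M) \<le> (\<integral>\<^sup>+\<omega>. 1 + ennreal (N s \<omega> powr \<beta>) \<partial>M)"
      using N0 by (intro nn_integral_mono) (auto simp flip: ennreal_1 ennreal_plus intro!: ennreal_leI)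
    also have "\<dots> = 1 + (\<integral>\<^sup>+\<omega>. ennreal (N s \<omega> powr \<beta>) \<partial>M)"
      by (subst nn_integral_add) (auto simp: emeasure_space_1)
    also have "(\<integral>\<^sup>+\<omega>. ennreal (N s \<omega> powr \<beta>) \<partial>M)
        = (\<integral>\<^sup>+\<omega>. nn_cond_exp M (F s) (\<lambda>\<omega>. ennreal (N s \<omega> powr \<beta>)) \<omega> \<partial>M)"
      using nn_cond_exp_intg[of "\<lambda>_. 1" "\<lambda>\<omega>. ennreal (N s \<omega> powr \<beta>)"] by simp
    also have "\<dots> \<le> (\<integral>\<^sup>+\<omega>. C \<partial>M)"
      using assms(12)[of s] unfolding N_def by (intro nn_integral_mono_AE) auto
    also have "\<dots> = C"
      by (simp add: emeasure_space_1)
    finally show ?thesis by (simp add: add_left_mono)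
  qed
  then have "AE \<omega> in M. \<exists>W. \<forall>t. (\<Sum>s<t. N s \<omega> powr b) \<le> W * real t powr (1 + \<delta>)"
    using assms(9) \<delta>(1) by (intro AE_partial_sums_le_powr[where K = "1 + C"]) auto
  then show ?thesis
    using jump AE_space
  proof eventually_elim
    case (elim \<omega>)
    then obtain W where W: "(\<Sum>s<t. N s \<omega> powr b) \<le> W * real t powr (1 + \<delta>)" for t
      by blast
    \<comment> \<open>The absolute value makes the bound nonnegative, as monotonicity and multiplicativity of
      \<open>powr\<close> require.\<close>
    define K where "K = \<bar>W\<bar> powr (1 / b)"
    have down: "(\<Sum>s<t. N s \<omega>) \<le> K * real t powr ((1 + \<delta>) / b)" for t
    proof -
      have "(\<Sum>s<t. N s \<omega> powr b) \<le> \<bar>W\<bar> * real t powr (1 + \<delta>)"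
        by (rule order.trans[OF W]) (intro mult_right_mono, auto)
      then have "(\<Sum>s<t. N s \<omega> powr b) powr (1 / b) \<le> (\<bar>W\<bar> * real t powr (1 + \<delta>)) powr (1 / b)"
        using b by (intro powr_mono2) (auto intro: sum_nonneg)
      also have "\<dots> = K * real t powr ((1 + \<delta>) / b)"
        by (simp add: K_def powr_mult powr_powr)
      finally show ?thesis
        using sum_le_sum_powr[of "{..<t}" "\<lambda>s. N s \<omega>" b] b N0 by auto
    qed
    have "\<forall>\<^sub>F t in sequentially. K * real t powr ((1 + \<delta>) / b) \<le> bd t"
      unfolding bd_def using \<delta>(2) assms(6,14) by real_asymp
    moreover have "\<forall>\<^sub>F t in sequentially. \<exists>s<t. P s \<omega> > 2 * bd t"
      using elim by (simp add: cofinite_eq_sequentially)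
    ultimately have "\<forall>\<^sub>F t in sequentially. bd t \<le> X t \<omega>"
    proof eventually_elim
      case (elim t)
      then obtain s where s: "s < t" "P s \<omega> > 2 * bd t"
        by blast
      have "X t \<omega> = (\<Sum>r<t. increment X r \<omega>)"
        using sum_lessThan_telescope[of "\<lambda>r. X r \<omega>" t] assms(5)[OF \<open>\<omega> \<in> space M\<close>]
        by (simp add: increment_def)
      also have "\<dots> = (\<Sum>r<t. P r \<omega> - N r \<omega>)"
        by (rule sum.cong) (auto simp: P_def N_def plus_part_def minus_part_def)
      also have "\<dots> = (\<Sum>r<t. P r \<omega>) - (\<Sum>r<t. N r \<omega>)"
        by (rule sum_subtractf)
      finally have "X t \<omega> = (\<Sum>r<t. P r \<omega>) - (\<Sum>r<t. N r \<omega>)" .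
      moreover have "P s \<omega> \<le> (\<Sum>r<t. P r \<omega>)"
        using s P0 by (intro member_le_sum) auto
      ultimately show ?case
        using s(2) down[of t] elim(1) by linarith
    qed
    then show ?case
      by (simp add: cofinite_eq_sequentially bd_def)
  qed
qed

end
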